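(* Let $H$ be an infinite-dimensional separable complex Hilbert space and let $T\in\mathcal{B}(H)$. Then $T\in\beta_0(H)$ if and only if $|T|$ has pure point spectrum and $\sigma_p(|T|)$ is reverse well-ordered. In this case, $$|T|=\sum_{\lambda\in\sigma_p(|T|)}\lambda\,E_{|T|}(\{\lambda\}),$$ where $E_{|T|}(\{\lambda\})$ is the orthogonal projection onto $\ker(|T|-\lambda I)$, and the sum converges in the strong operator topology.
   Context: $\mathcal{B}(H)$ is the algebra of bounded linear operators on $H$. A closed subspace $M\subseteq H$ is reducing for $T\in\mathcal{B}(H)$ if $TM\subseteq M$ and $TM^\perp\subseteq M^\perp$; $\mathcal{R}_T$ denotes the collection of all reducing subspaces of $T$. For $M\in\mathcal{R}_T$ non-zero, the restriction $T|_M$ is norm attaining if there is a unit vector $x\in M$ with $\|Tx\|=\|T|_M\|$, where $\|T|_M\|=\sup\{\|Ty\|:y\in M,\|y\|=1\}$. Put $|T|:=(T^*T)^{1/2}$ and $$\beta(H):=\{T\in\mathcal{B}(H): T|_M \text{ is norm attaining for every non-zero } M\in\mathcal{R}_T\},\qquad \beta_0(H):=\{T\in\mathcal{B}(H): |T|\in\beta(H)\}.$$ For $S\in\mathcal{B}(H)$, $\sigma_p(S)$ is the set of eigenvalues of $S$ (the $\lambda\in\mathbb{C}$ with $S-\lambda I$ not injective). $S$ has pure point spectrum if the closed linear span of its eigenvectors is all of $H$. A subset $\Lambda\subseteq\mathbb{R}$ is reverse well-ordered if every non-empty subset of $\Lambda$ has a greatest element. *)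

theory Defs
  imports "HOL-Analysis.Analysis"
begin

section \<open>Complex Hilbert spaces\<close>

text \<open>
  A complex Hilbert space, built on top of the library's complete real inner product spaces:
  the underlying real inner product is the real part of the complex one, so that the norm,
  \<open>norm x = sqrt (inner x x) = sqrt (Re (cinner x x))\<close>, and the topology are the library's.
  The complex inner product is linear in its first argument.
\<close>

class complex_hilbert_space = real_inner + complete_space +
  fixes scaleC :: "complex \<Rightarrow> 'a \<Rightarrow> 'a"  (infixr \<open>*\<^sub>C\<close> 75)
    and cinner :: "'a \<Rightarrow> 'a \<Rightarrow> complex"
  assumes scaleC_add_right: "c *\<^sub>C (x + y) = c *\<^sub>C x + c *\<^sub>C y"
    and scaleC_add_left: "(c + d) *\<^sub>C x = c *\<^sub>C x + d *\<^sub>C x"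
    and scaleC_scaleC: "c *\<^sub>C d *\<^sub>C x = (c * d) *\<^sub>C x"
    and scaleC_one: "1 *\<^sub>C x = x"
    and scaleR_eq_scaleC: "r *\<^sub>R x = complex_of_real r *\<^sub>C x"
    and cinner_commute: "cinner x y = cnj (cinner y x)"
    and cinner_add_left: "cinner (x + y) z = cinner x z + cinner y z"
    and cinner_scaleC_left: "cinner (c *\<^sub>C x) y = c * cinner x y"
    and inner_eq_Re_cinner: "inner x y = Re (cinner x y)"

instantiation complex :: complex_hilbert_space
begin

definition scaleC_complex :: "complex \<Rightarrow> complex \<Rightarrow> complex"
  where "scaleC_complex = (*)"

definition cinner_complex :: "complex \<Rightarrow> complex \<Rightarrow> complex"
  where "cinner_complex x y = x * cnj y"

instance
  by standard
    (auto simp: scaleC_complex_def cinner_complex_def inner_complex_def algebra_simps scaleR_conv_of_real)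

end

global_interpretation complex_vector:
  vector_space "scaleC :: complex \<Rightarrow> 'a \<Rightarrow> 'a::complex_hilbert_space"
  defines csubspace = complex_vector.subspace
    and cspan = complex_vector.span
  by unfold_locales (simp_all add: scaleC_add_right scaleC_add_left scaleC_scaleC scaleC_one)

lemma cinner_self: "cinner x x = complex_of_real ((norm x)\<^sup>2)"
  for x :: "'a::complex_hilbert_space"
proof -
  have "cinner x x \<in> \<real>"
    using cinner_commute[of x x] by (metis Reals_cnj_iff)
  then show ?thesis
    by (simp add: complex_is_Real_iff complex_eq_iff power2_norm_eq_inner inner_eq_Re_cinner)
qed

definition corthogonal_complement :: "'a::complex_hilbert_space set \<Rightarrow> 'a set"
  where "corthogonal_complement M = {y. \<forall>x\<in>M. cinner y x = 0}"

section \<open>Bounded operators\<close>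

definition bounded_clinear ::
    "('a::complex_hilbert_space \<Rightarrow> 'b::complex_hilbert_space) \<Rightarrow> bool"
  where "bounded_clinear T \<longleftrightarrow> bounded_linear T \<and> (\<forall>c x. T (c *\<^sub>C x) = c *\<^sub>C T x)"

definition cadjoint :: "('a::complex_hilbert_space \<Rightarrow> 'a) \<Rightarrow> 'a \<Rightarrow> 'a"
  where "cadjoint T = (THE S. \<forall>x y. cinner (T x) y = cinner x (S y))"

text \<open>Over the complex numbers, positivity of the quadratic form entails self-adjointness.\<close>

definition positive_operator :: "('a::complex_hilbert_space \<Rightarrow> 'a) \<Rightarrow> bool"
  where "positive_operator A \<longleftrightarrow>
    bounded_clinear A \<and> (\<forall>x. cinner (A x) x \<in> \<real> \<and> 0 \<le> Re (cinner (A x) x))"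

definition sqrt_operator :: "('a::complex_hilbert_space \<Rightarrow> 'a) \<Rightarrow> 'a \<Rightarrow> 'a"
  where "sqrt_operator P = (THE A. positive_operator A \<and> A \<circ> A = P)"

definition abs_operator :: "('a::complex_hilbert_space \<Rightarrow> 'a) \<Rightarrow> 'a \<Rightarrow> 'a"
  where "abs_operator T = sqrt_operator (cadjoint T \<circ> T)"

section \<open>Reducing subspaces and norm attainment\<close>

definition reducing_subspaces :: "('a::complex_hilbert_space \<Rightarrow> 'a) \<Rightarrow> 'a set set"
  where "reducing_subspaces T =
    {M. csubspace M \<and> closed M \<and> T ` M \<subseteq> M \<and>
        T ` corthogonal_complement M \<subseteq> corthogonal_complement M}"

definition restriction_norm :: "('a::complex_hilbert_space \<Rightarrow> 'a) \<Rightarrow> 'a set \<Rightarrow> real"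
  where "restriction_norm T M = (SUP y\<in>{y\<in>M. norm y = 1}. norm (T y))"

definition norm_attaining_on :: "('a::complex_hilbert_space \<Rightarrow> 'a) \<Rightarrow> 'a set \<Rightarrow> bool"
  where "norm_attaining_on T M \<longleftrightarrow>
    (\<exists>x\<in>M. norm x = 1 \<and> norm (T x) = restriction_norm T M)"

definition beta :: "('a::complex_hilbert_space \<Rightarrow> 'a) set"
  where "beta =
    {T. bounded_clinear T \<and> (\<forall>M\<in>reducing_subspaces T. M \<noteq> {0} \<longrightarrow> norm_attaining_on T M)}"

definition beta0 :: "('a::complex_hilbert_space \<Rightarrow> 'a) set"
  where "beta0 = {T. bounded_clinear T \<and> abs_operator T \<in> beta}"

section \<open>Point spectrum\<close>

definition point_spectrum :: "('a::complex_hilbert_space \<Rightarrow> 'a) \<Rightarrow> complex set"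
  where "point_spectrum S = {\<mu>. \<not> inj (\<lambda>x. S x - \<mu> *\<^sub>C x)}"

definition eigenspace :: "('a::complex_hilbert_space \<Rightarrow> 'a) \<Rightarrow> complex \<Rightarrow> 'a set"
  where "eigenspace S \<mu> = {x. S x - \<mu> *\<^sub>C x = 0}"

definition pure_point_spectrum :: "('a::complex_hilbert_space \<Rightarrow> 'a) \<Rightarrow> bool"
  where "pure_point_spectrum S \<longleftrightarrow>
    closure (cspan {x. x \<noteq> 0 \<and> (\<exists>\<mu>. S x = \<mu> *\<^sub>C x)}) = UNIV"

text \<open>
  The point spectrum is a set of complex numbers, so a reverse well-ordered set of reals is
  represented by a set of complex numbers contained in \<open>\<real>\<close>, compared by real parts.
\<close>

definition reverse_well_ordered :: "complex set \<Rightarrow> bool"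
  where "reverse_well_ordered \<Lambda> \<longleftrightarrow>
    \<Lambda> \<subseteq> \<real> \<and> (\<forall>S. S \<subseteq> \<Lambda> \<and> S \<noteq> {} \<longrightarrow> (\<exists>g\<in>S. \<forall>s\<in>S. Re s \<le> Re g))"

definition orthogonal_projection :: "'a::complex_hilbert_space set \<Rightarrow> 'a \<Rightarrow> 'a"
  where "orthogonal_projection M x = (THE p. p \<in> M \<and> x - p \<in> corthogonal_complement M)"

definition eigenprojection ::
    "('a::complex_hilbert_space \<Rightarrow> 'a) \<Rightarrow> complex \<Rightarrow> 'a \<Rightarrow> 'a"
  where "eigenprojection S \<mu> = orthogonal_projection (eigenspace S \<mu>)"

text \<open>Unordered summation in the strong operator topology: convergence at every vector.\<close>

definition has_sum_sot ::
    "('i \<Rightarrow> 'a::complex_hilbert_space \<Rightarrow> 'a) \<Rightarrow> ('a \<Rightarrow> 'a) \<Rightarrow> 'i set \<Rightarrow> bool"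
  where "has_sum_sot F A I \<longleftrightarrow> (\<forall>x. ((\<lambda>i. F i x) has_sum A x) I)"

end

theory Submission
  imports Defs
begin

text \<open>
  Everything happens for the positive operator \<open>A = |T|\<close>. That \<open>|T|\<close> is a positive operator at all
  rests on the existence of adjoints (\<open>riesz_representation\<close>, by way of \<open>projection_exists\<close>) and of
  unique positive square roots (\<open>positive_sqrt_exists\<close>, \<open>commuting_positive_sqrt_unique\<close>).

  The link between norm attainment and eigenvalues is \<open>norm_attaining_vector_is_eigenvector\<close>: if
  \<open>A\<close> attains its norm \<open>s\<close> on an invariant subspace at \<open>x\<close>, then \<open>A x = s x\<close>. Suppose the norm is
  attained on every reducing subspace. The orthogonal complement of all eigenvectors is reducing
  and contains no eigenvector, so it is trivial: the spectrum is pure point. For a non-empty set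
  \<open>S\<close> of eigenvalues, the closed span of the corresponding eigenspaces is reducing; the norm of \<open>A\<close>
  there is an eigenvalue that bounds \<open>S\<close>, and by orthogonality of eigenspaces it lies in \<open>S\<close>. This
  is the greatest element.

  Conversely, pure point spectrum gives the expansions \<open>x = \<Sum> P\<^sub>\<mu> x\<close> and \<open>A x = \<Sum> \<mu> P\<^sub>\<mu> x\<close>, where
  \<open>P\<^sub>\<mu>\<close> projects onto the eigenspace for \<open>\<mu>\<close> (\<open>eigenexpansion_has_sum\<close>,
  \<open>apply_eigenexpansion_has_sum\<close>); the second one is the asserted formula. The projections \<open>P\<^sub>\<mu>\<close>
  preserve every reducing subspace \<open>M\<close>, so on \<open>M\<close> only the eigenvalues with an eigenvector in \<open>M\<close>
  enter. By the order hypothesis they have a greatest element \<open>g\<close>; Pythagoras bounds the norm of \<open>A\<close>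
  on \<open>M\<close> by \<open>g\<close>, and an eigenvector in \<open>M\<close> for \<open>g\<close> attains it.
\<close>

section \<open>Complex inner products\<close>

subclass (in complex_hilbert_space) banach ..

lemma cinner_add_right: "cinner x (y + z) = cinner x y + cinner x z"
  by (metis cinner_add_left cinner_commute complex_cnj_add)

lemma cinner_scaleC_right: "cinner x (c *\<^sub>C y) = cnj c * cinner x y"
  by (metis cinner_scaleC_left cinner_commute complex_cnj_mult)

lemma cinner_zero_left [simp]: "cinner 0 x = 0"
  using cinner_add_left[of 0 0 x] by simp

lemma cinner_zero_right [simp]: "cinner x 0 = 0"
  using cinner_add_right[of x 0 0] by simp

lemma cinner_diff_left: "cinner (x - y) z = cinner x z - cinner y z"
  using cinner_add_left[of "x - y" y z] by simp

lemma cinner_diff_right: "cinner x (y - z) = cinner x y - cinner x z"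
  using cinner_add_right[of x "y - z" z] by simp

lemma cinner_scaleR_left: "cinner (r *\<^sub>R x) y = complex_of_real r * cinner x y"
  by (simp add: scaleR_eq_scaleC cinner_scaleC_left)

lemma cinner_scaleR_right: "cinner x (r *\<^sub>R y) = complex_of_real r * cinner x y"
  by (simp add: scaleR_eq_scaleC cinner_scaleC_right)

lemma cinner_eq_zero_commute: "cinner x y = 0 \<longleftrightarrow> cinner y x = 0"
  by (metis cinner_commute complex_cnj_zero_iff)

lemma Im_cinner: "Im (cinner x y) = inner x (\<i> *\<^sub>C y)"
  by (simp add: inner_eq_Re_cinner cinner_scaleC_right)

lemma norm_scaleC: "norm (c *\<^sub>C x) = cmod c * norm x"
proof -
  have "complex_of_real ((norm (c *\<^sub>C x))\<^sup>2) = c * cnj c * complex_of_real ((norm x)\<^sup>2)"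
    unfolding cinner_self[symmetric] by (simp add: cinner_scaleC_left cinner_scaleC_right)
  also have "\<dots> = complex_of_real ((cmod c * norm x)\<^sup>2)"
    by (simp add: complex_norm_square[symmetric] power_mult_distrib)
  finally have "(norm (c *\<^sub>C x))\<^sup>2 = (cmod c * norm x)\<^sup>2"
    using of_real_eq_iff by blast
  then show ?thesis
    by (simp add: power2_eq_iff_nonneg)
qed

lemma norm_cinner_le: "cmod (cinner x y) \<le> norm x * norm y"
proof (cases "cinner x y = 0")
  case False
  \<comment> \<open>Rotating \<open>x\<close> by a unit scalar reduces the claim to the real Cauchy-Schwarz inequality.\<close>
  define c where "c = cnj (sgn (cinner x y))"
  have "c * cinner x y = complex_of_real (cmod (cinner x y))"
    using False by (simp add: c_def sgn_eq complex_norm_square[symmetric] power2_eq_square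
        mult.commute)
  then have "cmod (cinner x y) = inner (c *\<^sub>C x) y"
    by (simp add: inner_eq_Re_cinner cinner_scaleC_left)
  also have "\<dots> \<le> norm (c *\<^sub>C x) * norm y"
    by (rule norm_cauchy_schwarz)
  also have "\<dots> = norm x * norm y"
    using False by (simp add: norm_scaleC c_def norm_sgn)
  finally show ?thesis .
qed simp

lemma bounded_bilinear_cinner: "bounded_bilinear cinner"
proof
  show "\<exists>K. \<forall>a b. norm (cinner a b) \<le> norm a * norm b * K"
    by (rule exI[of _ 1]) (simp add: norm_cinner_le)
qed (simp_all add: cinner_add_left cinner_add_right cinner_scaleR_left cinner_scaleR_right
    scaleR_conv_of_real)

lemma bounded_linear_scaleC: "bounded_linear (\<lambda>x. c *\<^sub>C x)"
proof (rule bounded_linear_intro[where K = "cmod c"])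
  show "c *\<^sub>C r *\<^sub>R x = r *\<^sub>R c *\<^sub>C x" for r and x :: 'a
    by (simp add: scaleR_eq_scaleC scaleC_scaleC mult.commute)
qed (simp_all add: scaleC_add_right norm_scaleC)

lemmas continuous_on_cinner = bounded_bilinear.continuous_on[OF bounded_bilinear_cinner]
lemmas tendsto_cinner = bounded_bilinear.tendsto[OF bounded_bilinear_cinner]

lemma csubspace_scaleR: "csubspace M \<Longrightarrow> x \<in> M \<Longrightarrow> r *\<^sub>R x \<in> M"
  by (simp add: scaleR_eq_scaleC complex_vector.subspace_scale)

lemma csubspace_closure:
  assumes "csubspace M"
  shows "csubspace (closure M)"
proof (rule complex_vector.subspaceI)
  show "0 \<in> closure M"
    using complex_vector.subspace_0[OF assms] closure_subset by blast
next
  fix x y assume "x \<in> closure M" "y \<in> closure M"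
  then obtain f g where fg: "\<And>n. f n \<in> M" "f \<longlonglongrightarrow> x" "\<And>n. g n \<in> M" "g \<longlonglongrightarrow> y"
    unfolding closure_sequential by blast
  have "(\<lambda>n. f n + g n) \<longlonglongrightarrow> x + y"
    by (intro tendsto_add fg)
  then show "x + y \<in> closure M"
    unfolding closure_sequential using fg complex_vector.subspace_add[OF assms]
    by (intro exI[of _ "\<lambda>n. f n + g n"]) auto
next
  fix c x assume "x \<in> closure M"
  then obtain f where f: "\<And>n. f n \<in> M" "f \<longlonglongrightarrow> x"
    unfolding closure_sequential by blast
  have "(\<lambda>n. c *\<^sub>C f n) \<longlonglongrightarrow> c *\<^sub>C x"
    by (rule bounded_linear.tendsto[OF bounded_linear_scaleC f(2)])
  then show "c *\<^sub>C x \<in> closure M"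
    unfolding closure_sequential using f complex_vector.subspace_scale[OF assms]
    by (intro exI[of _ "\<lambda>n. c *\<^sub>C f n"]) auto
qed

section \<open>Orthogonal complements and projections\<close>

lemma mem_corthogonal_complement:
  "y \<in> corthogonal_complement M \<longleftrightarrow> (\<forall>x\<in>M. cinner y x = 0)"
  by (simp add: corthogonal_complement_def)

lemma csubspace_corthogonal_complement: "csubspace (corthogonal_complement M)"
  by (rule complex_vector.subspaceI)
    (auto simp: mem_corthogonal_complement cinner_add_left cinner_scaleC_left)

lemma closed_corthogonal_complement: "closed (corthogonal_complement M)"
proof -
  have "corthogonal_complement M = (\<Inter>x\<in>M. {y. cinner y x = 0})"
    by (auto simp: corthogonal_complement_def)
  moreover have "closed {y. cinner y x = 0}" for x :: 'a
    by (intro closed_Collect_eq continuous_on_cinner continuous_intros)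
  ultimately show ?thesis
    by auto
qed

lemma corthogonal_complement_antimono:
  "M \<subseteq> N \<Longrightarrow> corthogonal_complement N \<subseteq> corthogonal_complement M"
  unfolding corthogonal_complement_def by blast

lemma subset_double_complement: "M \<subseteq> corthogonal_complement (corthogonal_complement M)"
  using cinner_eq_zero_commute by (fastforce simp: mem_corthogonal_complement)

lemma triple_complement:
  "corthogonal_complement (corthogonal_complement (corthogonal_complement M))
    = corthogonal_complement M"
  by (intro equalityI corthogonal_complement_antimono subset_double_complement)

lemma corthogonal_complement_closure_cspan:
  "corthogonal_complement (closure (cspan G)) = corthogonal_complement G"
proof
  show "corthogonal_complement (closure (cspan G)) \<subseteq> corthogonal_complement G"
    by (intro corthogonal_complement_antimono
        order_trans[OF complex_vector.span_superset closure_subset])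
  have "cspan G \<subseteq> corthogonal_complement (corthogonal_complement G)"
    by (intro complex_vector.span_minimal subset_double_complement
        csubspace_corthogonal_complement)
  then have "closure (cspan G) \<subseteq> corthogonal_complement (corthogonal_complement G)"
    by (intro closure_minimal closed_corthogonal_complement)
  then show "corthogonal_complement G \<subseteq> corthogonal_complement (closure (cspan G))"
    using corthogonal_complement_antimono triple_complement by metis
qed

text \<open>The parallelogram law bounds the distance between two nearly closest points of a subspace
  by how far each is from being optimal; minimizing sequences are therefore Cauchy.\<close>

lemma norm_diff_near_minimizers:
  fixes x p q :: "'a::complex_hilbert_space"
  assumes M: "csubspace M" "p \<in> M" "q \<in> M"
    and d: "\<And>m. m \<in> M \<Longrightarrow> d \<le> (norm (x - m))\<^sup>2"
    and "(norm (x - p))\<^sup>2 \<le> d + e" "(norm (x - q))\<^sup>2 \<le> d + e"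
  shows "(norm (p - q))\<^sup>2 \<le> 4 * e"
proof -
  have "(1/2) *\<^sub>R (p + q) \<in> M"
    using M by (simp add: csubspace_scaleR complex_vector.subspace_add)
  then have "4 * d \<le> 4 * (norm (x - (1/2) *\<^sub>R (p + q)))\<^sup>2"
    using d by auto
  also have "\<dots> = 2 * (norm (x - p))\<^sup>2 + 2 * (norm (x - q))\<^sup>2 - (norm (p - q))\<^sup>2"
    unfolding power2_norm_eq_inner
    by (simp add: inner_diff_left inner_diff_right inner_add_left inner_add_right inner_commute
        algebra_simps)
  finally show ?thesis
    using assms(5,6) by linarith
qed

text \<open>Minimality along real lines only yields orthogonality for the real inner product; the
  imaginary part follows because the subspace is closed under multiplication by \<open>\<i>\<close>.\<close>

lemma closest_point_orthogonal:
  fixes x p :: "'a::complex_hilbert_space"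
  assumes M: "csubspace M" "p \<in> M"
    and closest: "\<And>m. m \<in> M \<Longrightarrow> norm (x - p) \<le> norm (x - m)"
  shows "x - p \<in> corthogonal_complement M"
proof -
  have real_orth: "inner (x - p) m = 0" if "m \<in> M" for m
  proof (rule ccontr)
    assume nz: "inner (x - p) m \<noteq> 0"
    then have m: "m \<noteq> 0" by auto
    define t where "t = inner (x - p) m / inner m m"
    have "p + t *\<^sub>R m \<in> M"
      using M that by (simp add: csubspace_scaleR complex_vector.subspace_add)
    then have "(norm (x - p))\<^sup>2 \<le> (norm ((x - p) - t *\<^sub>R m))\<^sup>2"
      using closest[of "p + t *\<^sub>R m"] by (simp add: algebra_simps)
    also have "\<dots> = (norm (x - p))\<^sup>2 - 2 * t * inner (x - p) m + t\<^sup>2 * inner m m"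
      unfolding power2_norm_eq_inner
      by (simp add: inner_diff_left inner_diff_right inner_commute algebra_simps power2_eq_square)
    also have "\<dots> = (norm (x - p))\<^sup>2 - (inner (x - p) m)\<^sup>2 / inner m m"
      using m by (simp add: t_def field_simps power2_eq_square)
    finally have "(inner (x - p) m)\<^sup>2 / inner m m \<le> 0"
      by simp
    moreover have "(inner (x - p) m)\<^sup>2 / inner m m > 0"
      using nz m by simp
    ultimately show False by simp
  qed
  show ?thesis
    unfolding mem_corthogonal_complement
  proof
    fix m assume "m \<in> M"
    then have "\<i> *\<^sub>C m \<in> M"
      using M by (simp add: complex_vector.subspace_scale)
    with real_orth \<open>m \<in> M\<close> show "cinner (x - p) m = 0"
      by (simp add: complex_eq_iff Im_cinner flip: inner_eq_Re_cinner)
  qed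
qed

theorem projection_exists:
  fixes M :: "'a::complex_hilbert_space set"
  assumes M: "csubspace M" "closed M"
  shows "\<exists>p\<in>M. x - p \<in> corthogonal_complement M"
proof -
  define d where "d = (INF m\<in>M. (norm (x - m))\<^sup>2)"
  have ne: "M \<noteq> {}"
    using complex_vector.subspace_0[OF M(1)] by auto
  have bdd: "bdd_below ((\<lambda>m. (norm (x - m))\<^sup>2) ` M)"
    by (rule bdd_belowI[of _ 0]) auto
  have d: "d \<le> (norm (x - m))\<^sup>2" if "m \<in> M" for m
    unfolding d_def by (rule cINF_lower[OF bdd that])
  have "\<exists>m\<in>M. (norm (x - m))\<^sup>2 < d + inverse (Suc n)" for n
    using cINF_less_iff[OF ne bdd, of "d + inverse (Suc n)"] by (simp add: d_def)
  then obtain f where f: "\<And>n. f n \<in> M" "\<And>n. (norm (x - f n))\<^sup>2 < d + inverse (Suc n)"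
    by metis
  have "Cauchy f"
  proof (rule metric_CauchyI)
    fix e :: real assume e: "e > 0"
    then obtain N where N: "inverse (Suc N) < e\<^sup>2 / 4"
      using reals_Archimedean[of "e\<^sup>2 / 4"] by auto
    have "dist (f m) (f n) < e" if "m \<ge> N" "n \<ge> N" for m n
    proof -
      have "inverse (Suc k) \<le> inverse (real (Suc N))" if "k \<ge> N" for k
        using that by (intro le_imp_inverse_le) auto
      then have "(norm (x - f k))\<^sup>2 \<le> d + inverse (Suc N)" if "k \<ge> N" for k
        using f(2)[of k] that by (meson add_left_mono less_imp_le order_trans)
      then have "(norm (f m - f n))\<^sup>2 \<le> 4 * inverse (Suc N)"
        using norm_diff_near_minimizers[OF M(1) f(1) f(1) d] that by blast
      also have "\<dots> < e\<^sup>2" using N by simp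
      finally show ?thesis
        using e by (simp add: dist_norm power2_less_imp_less)
    qed
    then show "\<exists>N. \<forall>m\<ge>N. \<forall>n\<ge>N. dist (f m) (f n) < e" by blast
  qed
  then obtain p where p: "f \<longlonglongrightarrow> p"
    using Cauchy_convergent convergent_def by blast
  have pM: "p \<in> M"
    using M(2) f(1) p closed_sequentially by blast
  have "(\<lambda>n. (norm (x - f n))\<^sup>2) \<longlonglongrightarrow> (norm (x - p))\<^sup>2"
    by (intro tendsto_intros p)
  moreover have "(\<lambda>n. d + inverse (real (Suc n))) \<longlonglongrightarrow> d + 0"
    by (intro tendsto_add tendsto_const LIMSEQ_inverse_real_of_nat)
  ultimately have "(norm (x - p))\<^sup>2 \<le> d"
    using f(2) by (intro LIMSEQ_le[where Y = "\<lambda>n. d + inverse (real (Suc n))"])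
      (auto intro!: less_imp_le)
  then have "norm (x - p) \<le> norm (x - m)" if "m \<in> M" for m
    using d[OF that] by (meson norm_ge_zero order_trans power2_le_imp_le)
  then show ?thesis
    using closest_point_orthogonal[OF M(1) pM] pM by blast
qed

lemma complement_disjoint:
  assumes "x \<in> M" "x \<in> corthogonal_complement M"
  shows "x = 0"
  using assms cinner_self[of x] by (auto simp: mem_corthogonal_complement)

lemma orthogonal_projection_eqI:
  assumes M: "csubspace M" and p: "p \<in> M" "x - p \<in> corthogonal_complement M"
  shows "orthogonal_projection M x = p"
  unfolding orthogonal_projection_def
proof (rule the_equality)
  fix q assume q: "q \<in> M \<and> x - q \<in> corthogonal_complement M"
  have "(x - p) - (x - q) \<in> corthogonal_complement M"
    using p q csubspace_corthogonal_complement complex_vector.subspace_diff by blast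
  moreover have "(x - p) - (x - q) = q - p" by simp
  ultimately have "q - p \<in> corthogonal_complement M" by simp
  moreover have "q - p \<in> M"
    using M p q complex_vector.subspace_diff by blast
  ultimately show "q = p"
    using complement_disjoint by fastforce
qed (use p in simp)

lemma orthogonal_projection:
  assumes "csubspace M" "closed M"
  shows "orthogonal_projection M x \<in> M"
    and "x - orthogonal_projection M x \<in> corthogonal_complement M"
  using projection_exists[OF assms, of x] orthogonal_projection_eqI[OF assms(1), of _ x] by auto

lemma closure_cspan_eq_UNIV_iff:
  "closure (cspan G) = UNIV \<longleftrightarrow> corthogonal_complement G = {0}"
proof
  assume "closure (cspan G) = UNIV"
  then have "corthogonal_complement G = corthogonal_complement UNIV"
    using corthogonal_complement_closure_cspan by metis
  then show "corthogonal_complement G = {0}"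
    using complement_disjoint[of _ UNIV] by (auto simp: mem_corthogonal_complement)
next
  assume G: "corthogonal_complement G = {0}"
  have "x \<in> closure (cspan G)" for x
    using projection_exists[of "closure (cspan G)" x]
    by (auto simp: csubspace_closure corthogonal_complement_closure_cspan G)
  then show "closure (cspan G) = UNIV" by auto
qed

section \<open>Adjoints\<close>

lemma bounded_clinearD:
  assumes "bounded_clinear T"
  shows "bounded_linear T" "T (x + y) = T x + T y" "T (x - y) = T x - T y"
    "T (c *\<^sub>C x) = c *\<^sub>C T x" "T (r *\<^sub>R x) = r *\<^sub>R T x" "T 0 = 0"
proof -
  show b: "bounded_linear T"
    using assms by (simp add: bounded_clinear_def)
  show "T (c *\<^sub>C x) = c *\<^sub>C T x"
    using assms by (simp add: bounded_clinear_def)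
  interpret T: bounded_linear T by (rule b)
  show "T (x + y) = T x + T y" "T (x - y) = T x - T y" "T (r *\<^sub>R x) = r *\<^sub>R T x" "T 0 = 0"
    by (simp_all add: T.add T.diff T.scaleR T.zero)
qed

theorem riesz_representation:
  fixes f :: "'a::complex_hilbert_space \<Rightarrow> complex"
  assumes f: "bounded_clinear f"
  shows "\<exists>w. \<forall>x. f x = cinner x w"
proof (cases "\<forall>x. f x = 0")
  case True
  then show ?thesis by (auto intro!: exI[of _ 0])
next
  case False
  then obtain z where z: "f z \<noteq> 0" by blast
  define K where "K = {x. f x = 0}"
  have "csubspace K"
    unfolding K_def by (rule complex_vector.subspaceI)
      (auto simp: bounded_clinearD[OF f] scaleC_complex_def)
  moreover have "closed K"
    unfolding K_def
    by (intro closed_Collect_eq continuous_intros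
        linear_continuous_on[OF bounded_clinearD(1)[OF f]])
  ultimately obtain p where p: "p \<in> K" "z - p \<in> corthogonal_complement K"
    using projection_exists by blast
  define w where "w = z - p"
  have fw: "f w \<noteq> 0"
    using z p(1) by (simp add: w_def bounded_clinearD[OF f] K_def)
  have ww: "cinner w w \<noteq> 0"
    using fw by (auto simp: cinner_self bounded_clinearD(6)[OF f])
  have "f x = cinner x (cnj (f w / cinner w w) *\<^sub>C w)" for x
  proof -
    \<comment> \<open>The vector \<open>f w x - f x w\<close> lies in the kernel, to which \<open>w\<close> is orthogonal.\<close>
    have "f w *\<^sub>C x - f x *\<^sub>C w \<in> K"
      by (simp add: K_def bounded_clinearD[OF f] scaleC_complex_def)
    then have "cinner (f w *\<^sub>C x - f x *\<^sub>C w) w = 0"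
      using p(2) cinner_eq_zero_commute by (auto simp: w_def mem_corthogonal_complement)
    then show ?thesis
      using ww by (simp add: cinner_diff_left cinner_scaleC_left cinner_scaleC_right field_simps)
  qed
  then show ?thesis by blast
qed

lemma cinner_ext: "(\<And>x. cinner x y = cinner x z) \<Longrightarrow> y = z"
  using cinner_self[of "y - z"] cinner_diff_right[of "y - z" y z] by simp

lemma cinner_cadjoint:
  assumes T: "bounded_clinear T"
  shows "cinner (T x) y = cinner x (cadjoint T y)"
proof -
  have "bounded_clinear (\<lambda>x. cinner (T x) y)" for y
    unfolding bounded_clinear_def
    using bounded_linear_compose[OF
        bounded_bilinear.bounded_linear_left[OF bounded_bilinear_cinner] bounded_clinearD(1)[OF T]]
    by (auto simp: bounded_clinearD[OF T] cinner_scaleC_left scaleC_complex_def)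
  then have "\<forall>y. \<exists>w. \<forall>x. cinner (T x) y = cinner x w"
    using riesz_representation by blast
  then have "\<exists>S. \<forall>y x. cinner (T x) y = cinner x (S y)"
    by (rule choice)
  then obtain S where S: "\<forall>x y. cinner (T x) y = cinner x (S y)"
    by blast
  have "cadjoint T = S"
    unfolding cadjoint_def
  proof (rule the_equality)
    fix R assume R: "\<forall>x y. cinner (T x) y = cinner x (R y)"
    have "R y = S y" for y
      by (rule cinner_ext, rule trans[OF R[rule_format, symmetric] S[rule_format]])
    then show "R = S" ..
  qed (rule S)
  then show ?thesis using S by simp
qed

lemma cinner_cadjoint':
  assumes "bounded_clinear T"
  shows "cinner (cadjoint T y) x = cinner y (T x)"
  using cinner_cadjoint[OF assms, of x y] by (metis cinner_commute)

lemma norm_cadjoint_le: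
  assumes T: "bounded_clinear T" and K: "\<And>x. norm (T x) \<le> K * norm x" "K \<ge> 0"
  shows "norm (cadjoint T y) \<le> K * norm y"
proof -
  define z where "z = cadjoint T y"
  have "(norm z)\<^sup>2 = cmod (cinner z z)"
    unfolding cinner_self by (simp add: norm_power)
  also have "\<dots> = cmod (cinner (T z) y)"
    by (simp add: cinner_cadjoint[OF T] z_def)
  also have "\<dots> \<le> norm (T z) * norm y"
    by (rule norm_cinner_le)
  also have "\<dots> \<le> K * norm z * norm y"
    by (intro mult_right_mono K) simp
  finally have "norm z * norm z \<le> (K * norm y) * norm z"
    by (simp add: power2_eq_square mult_ac)
  then show ?thesis
    using K(2) by (cases "z = 0") (auto simp flip: z_def)
qed

lemma bounded_clinear_cadjoint:
  assumes T: "bounded_clinear T"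
  shows "bounded_clinear (cadjoint T)"
proof -
  have add: "cadjoint T (x + y) = cadjoint T x + cadjoint T y" for x y
    by (rule cinner_ext) (simp add: cinner_add_right flip: cinner_cadjoint[OF T])
  have scaleC: "cadjoint T (c *\<^sub>C x) = c *\<^sub>C cadjoint T x" for c x
    by (rule cinner_ext) (simp add: cinner_scaleC_right flip: cinner_cadjoint[OF T])
  obtain K where "K > 0" "\<And>x. norm (T x) \<le> norm x * K"
    using bounded_linear.pos_bounded[OF bounded_clinearD(1)[OF T]] by blast
  then have "norm (cadjoint T x) \<le> norm x * K" for x
    using norm_cadjoint_le[OF T, of K x] by (simp add: mult.commute)
  then have "bounded_linear (cadjoint T)"
    by (intro bounded_linear_intro[where K = K]) (simp_all add: add scaleC scaleR_eq_scaleC)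
  then show ?thesis
    by (simp add: bounded_clinear_def scaleC)
qed

section \<open>Positive operators and their square roots\<close>

lemma positive_operatorD:
  assumes "positive_operator A"
  shows "bounded_clinear A" "cinner (A x) x \<in> \<real>" "0 \<le> inner (A x) x"
  using assms by (simp_all add: positive_operator_def inner_eq_Re_cinner)

lemma positive_operator_selfadjoint:
  assumes A: "positive_operator A"
  shows "cinner (A x) y = cinner x (A y)"
proof -
  note [simp] = bounded_clinearD[OF positive_operatorD(1)[OF A]]
  define s where "s u v = cinner (A u) v - cinner u (A v)" for u v
  \<comment> \<open>Polarization: the sesquilinear form \<open>s\<close> vanishes on the diagonal.\<close>
  have "s z z = 0" for z
    using positive_operatorD(2)[OF A, of z] cinner_commute[of z "A z"]
    by (simp add: s_def Reals_cnj_iff)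
  then have "s (x + y) (x + y) - s x x - s y y = 0"
    "s (x + \<i> *\<^sub>C y) (x + \<i> *\<^sub>C y) - s x x - s y y = 0"
    by simp_all
  then have "s x y + s y x = 0" "\<i> * (s y x - s x y) = 0"
    by (simp_all add: s_def cinner_add_left cinner_add_right cinner_scaleC_left
        cinner_scaleC_right algebra_simps)
  then have "s x y + s x y = 0"
    by simp
  then show ?thesis
    by (simp add: s_def)
qed

lemma positive_operator_inner:
  "positive_operator A \<Longrightarrow> inner (A x) y = inner x (A y)"
  by (simp add: inner_eq_Re_cinner positive_operator_selfadjoint)

lemma positive_operatorI:
  assumes "bounded_clinear A" "\<And>x y. cinner (A x) y = cinner x (A y)" "\<And>x. 0 \<le> inner (A x) x"
  shows "positive_operator A"
  unfolding positive_operator_def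
proof (intro conjI allI)
  show "cinner (A x) x \<in> \<real>" for x
    using assms(2)[of x x] cinner_commute[of x "A x"] by (metis Reals_cnj_iff)
qed (use assms in \<open>simp_all add: inner_eq_Re_cinner\<close>)

lemma nonneg_quadratic_discriminant:
  fixes a b c :: real
  assumes "0 \<le> c" "\<And>t. 0 \<le> a + 2 * b * t + c * t\<^sup>2"
  shows "b\<^sup>2 \<le> a * c"
proof (cases "c = 0")
  case True
  have "b = 0"
  proof (rule ccontr)
    assume "b \<noteq> 0"
    then show False
      using assms(2)[of "- (a + 1) / (2 * b)"] True by simp
  qed
  then show ?thesis using True by simp
next
  case False
  with assms(1) show ?thesis
    using assms(2)[of "- b / c"] by (simp add: field_simps power2_eq_square)
qed

text \<open>A positive operator turns \<open>inner (A x) y\<close> into a semi-inner product, so the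
  Cauchy-Schwarz inequality holds for it with the usual proof.\<close>

lemma positive_operator_cauchy_schwarz:
  assumes A: "positive_operator A"
  shows "(inner (A x) y)\<^sup>2 \<le> inner (A x) x * inner (A y) y"
proof (rule nonneg_quadratic_discriminant)
  show "0 \<le> inner (A y) y"
    by (rule positive_operatorD(3)[OF A])
next
  fix t
  note [simp] = bounded_clinearD[OF positive_operatorD(1)[OF A]]
  have "0 \<le> inner (A (x + t *\<^sub>R y)) (x + t *\<^sub>R y)"
    by (rule positive_operatorD(3)[OF A])
  also have "\<dots> = inner (A x) x + 2 * inner (A x) y * t + inner (A y) y * t\<^sup>2"
    using positive_operator_inner[OF A, of y x]
    by (simp add: inner_add_left inner_add_right inner_commute algebra_simps power2_eq_square)
  finally show "0 \<le> inner (A x) x + 2 * inner (A x) y * t + inner (A y) y * t\<^sup>2" .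
qed

lemma positive_operator_kernel:
  assumes A: "positive_operator A" and "inner (A x) x = 0"
  shows "A x = 0"
  using positive_operator_cauchy_schwarz[OF A, of x "A x"] assms(2) by simp

text \<open>For \<open>c \<ge> \<parallel>A\<parallel>\<close> the Cauchy-Schwarz inequality of the form at \<open>x\<close> and \<open>A x\<close> gives
  \<open>\<parallel>A x\<parallel>\<^sup>2 \<le> c \<langle>A x, x\<rangle>\<close>. This is what makes \<open>1 - A / c\<close> a contraction, to which the iteration
  for the square root applies.\<close>

lemma positive_operator_contraction:
  assumes A: "positive_operator A" and c: "c > 0" "\<And>x. norm (A x) \<le> c * norm x"
  shows "norm (x - (1 / c) *\<^sub>R A x) \<le> norm x"
proof -
  have "(norm (A x))\<^sup>2 * (norm (A x))\<^sup>2 \<le> inner (A x) x * inner (A (A x)) (A x)"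
    using positive_operator_cauchy_schwarz[OF A, of x "A x"]
    by (simp add: dot_square_norm power2_eq_square)
  also have "\<dots> \<le> inner (A x) x * (c * (norm (A x))\<^sup>2)"
  proof (rule mult_left_mono)
    have "inner (A (A x)) (A x) \<le> norm (A (A x)) * norm (A x)"
      by (rule norm_cauchy_schwarz)
    also have "\<dots> \<le> c * norm (A x) * norm (A x)"
      by (intro mult_right_mono c) simp
    finally show "inner (A (A x)) (A x) \<le> c * (norm (A x))\<^sup>2"
      by (simp add: power2_eq_square)
  qed (rule positive_operatorD(3)[OF A])
  finally have prod_le: "(norm (A x))\<^sup>2 * (norm (A x))\<^sup>2 \<le> (c * inner (A x) x) * (norm (A x))\<^sup>2"
    by (simp add: mult_ac)
  then have le: "(norm (A x))\<^sup>2 \<le> c * inner (A x) x"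
  proof (cases "A x = 0")
    case False
    then have "(norm (A x))\<^sup>2 > 0" by simp
    then show ?thesis
      using prod_le mult_right_le_imp_le by blast
  qed simp
  have "(norm (x - (1 / c) *\<^sub>R A x))\<^sup>2
      = (norm x)\<^sup>2 - 2 / c * inner (A x) x + (norm (A x))\<^sup>2 / c\<^sup>2"
    unfolding power2_norm_eq_inner
    by (simp add: inner_diff_left inner_diff_right inner_commute power2_eq_square)
  also have "(norm (A x))\<^sup>2 / c\<^sup>2 \<le> c * inner (A x) x / c\<^sup>2"
    by (intro divide_right_mono le) simp
  also have "c * inner (A x) x / c\<^sup>2 = inner (A x) x / c"
    using c(1) by (simp add: power2_eq_square)
  finally have "(norm (x - (1 / c) *\<^sub>R A x))\<^sup>2 \<le> (norm x)\<^sup>2 - inner (A x) x / c"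
    by (simp add: field_simps)
  also have "\<dots> \<le> (norm x)\<^sup>2"
    using positive_operatorD(3)[OF A, of x] c(1) by simp
  finally show ?thesis
    by (rule power2_le_imp_le) simp
qed

text \<open>If \<open>L\<close> solves \<open>L = (B + L\<^sup>2) / 2\<close> then \<open>(1 - L)\<^sup>2 = 1 - B\<close>, so the square root of
  \<open>1 - B\<close> comes out of the iteration \<open>Y \<mapsto> (B + Y\<^sup>2) / 2\<close>. The same iteration for the number \<open>1\<close>
  in place of \<open>B\<close> increases to a limit and majorizes the increments of the operator iteration,
  which therefore converges in norm as soon as \<open>B\<close> is a contraction.\<close>

primrec sqrt_iteration :: "('a::real_normed_vector \<Rightarrow>\<^sub>L 'a) \<Rightarrow> nat \<Rightarrow> 'a \<Rightarrow>\<^sub>L 'a" where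
  "sqrt_iteration B 0 = 0"
| "sqrt_iteration B (Suc n) = (1/2) *\<^sub>R (B + (sqrt_iteration B n o\<^sub>L sqrt_iteration B n))"

primrec scalar_sqrt_iteration :: "nat \<Rightarrow> real" where
  "scalar_sqrt_iteration 0 = 0"
| "scalar_sqrt_iteration (Suc n) = (1 + (scalar_sqrt_iteration n)\<^sup>2) / 2"

lemma scalar_sqrt_iteration_bounds: "0 \<le> scalar_sqrt_iteration n" "scalar_sqrt_iteration n \<le> 1"
proof (induction n)
  case (Suc n)
  show "0 \<le> scalar_sqrt_iteration (Suc n)" by simp
  show "scalar_sqrt_iteration (Suc n) \<le> 1"
    using Suc.IH by (simp add: power_le_one)
qed simp_all

lemma scalar_sqrt_iteration_step:
  "scalar_sqrt_iteration (Suc (Suc n)) - scalar_sqrt_iteration (Suc n)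
    = (scalar_sqrt_iteration (Suc n) + scalar_sqrt_iteration n)
      * (scalar_sqrt_iteration (Suc n) - scalar_sqrt_iteration n) / 2"
  by (simp add: field_simps power2_eq_square)

text \<open>The iterates are polynomials in \<open>B\<close>. Commutation is used three times: to factor a
  difference of squares, for the complex homogeneity of the root, and for its uniqueness.\<close>

lemma sqrt_iteration_commute:
  assumes "C o\<^sub>L B = B o\<^sub>L C"
  shows "C o\<^sub>L sqrt_iteration B n = sqrt_iteration B n o\<^sub>L C"
proof (induction n)
  case (Suc n)
  have C: "C (B x) = B (C x)" for x
    using assms by (metis blinfun_apply_blinfun_compose)
  have Y: "C (sqrt_iteration B n x) = sqrt_iteration B n (C x)" for x
    using Suc.IH by (metis blinfun_apply_blinfun_compose)
  show ?case
    by (rule blinfun_eqI) (simp add: blinfun.bilinear_simps C Y)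
qed simp

lemma norm_sqrt_iteration_le:
  assumes "norm B \<le> 1"
  shows "norm (sqrt_iteration B n) \<le> scalar_sqrt_iteration n"
proof (induction n)
  case (Suc n)
  have "norm (sqrt_iteration B n o\<^sub>L sqrt_iteration B n) \<le> (scalar_sqrt_iteration n)\<^sup>2"
    unfolding power2_eq_square
    by (rule order_trans[OF norm_blinfun_compose])
      (intro mult_mono Suc.IH scalar_sqrt_iteration_bounds norm_ge_zero)
  then show ?case
    using assms norm_triangle_ineq[of B "sqrt_iteration B n o\<^sub>L sqrt_iteration B n"]
    by simp
qed simp

lemma norm_sqrt_iteration_step_le:
  assumes B: "norm B \<le> 1"
  shows "norm (sqrt_iteration B (Suc n) - sqrt_iteration B n)
    \<le> scalar_sqrt_iteration (Suc n) - scalar_sqrt_iteration n"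
proof (induction n)
  case 0
  then show ?case using B by simp
next
  case (Suc n)
  let ?Y = "sqrt_iteration B n" and ?Z = "sqrt_iteration B (Suc n)"
  have "?Y o\<^sub>L B = B o\<^sub>L ?Y"
    using sqrt_iteration_commute[of B B n] by simp
  then have "?Y o\<^sub>L ?Z = ?Z o\<^sub>L ?Y"
    by (rule sqrt_iteration_commute)
  then have comm: "?Y (?Z x) = ?Z (?Y x)" for x
    by (metis blinfun_apply_blinfun_compose)
  have "sqrt_iteration B (Suc (Suc n)) - ?Z
      = (1/2) *\<^sub>R (B + (?Z o\<^sub>L ?Z)) - (1/2) *\<^sub>R (B + (?Y o\<^sub>L ?Y))"
    by (intro arg_cong2[where f = minus] sqrt_iteration.simps(2))
  also have "\<dots> = (1/2) *\<^sub>R ((?Z o\<^sub>L ?Z) - (?Y o\<^sub>L ?Y))"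
    by (simp add: algebra_simps del: sqrt_iteration.simps)
  also have "(?Z o\<^sub>L ?Z) - (?Y o\<^sub>L ?Y) = (?Z + ?Y) o\<^sub>L (?Z - ?Y)"
    by (rule blinfun_eqI) (simp add: blinfun.bilinear_simps comm del: sqrt_iteration.simps)
  finally have "norm (sqrt_iteration B (Suc (Suc n)) - ?Z)
      = norm ((?Z + ?Y) o\<^sub>L (?Z - ?Y)) / 2"
    by simp
  also have "\<dots> \<le> norm (?Z + ?Y) * norm (?Z - ?Y) / 2"
    by (simp add: norm_blinfun_compose del: sqrt_iteration.simps)
  also have "\<dots> \<le> (scalar_sqrt_iteration (Suc n) + scalar_sqrt_iteration n)
      * (scalar_sqrt_iteration (Suc n) - scalar_sqrt_iteration n) / 2"
    using norm_sqrt_iteration_le[OF B, of n] norm_sqrt_iteration_le[OF B, of "Suc n"]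
      norm_triangle_ineq[of ?Z ?Y] scalar_sqrt_iteration_bounds(1)[of n]
      scalar_sqrt_iteration_bounds(1)[of "Suc n"]
    by (intro divide_right_mono mult_mono Suc.IH) (linarith | simp)+
  also have "\<dots> = scalar_sqrt_iteration (Suc (Suc n)) - scalar_sqrt_iteration (Suc n)"
    by (rule scalar_sqrt_iteration_step[symmetric])
  finally show ?case .
qed

lemma norm_sqrt_iteration_diff_le:
  assumes B: "norm B \<le> 1" and "n \<le> m"
  shows "norm (sqrt_iteration B m - sqrt_iteration B n)
    \<le> scalar_sqrt_iteration m - scalar_sqrt_iteration n"
  using \<open>n \<le> m\<close>
proof (induction m rule: dec_induct)
  case (step m)
  have "norm (sqrt_iteration B (Suc m) - sqrt_iteration B n)
      \<le> norm (sqrt_iteration B (Suc m) - sqrt_iteration B m)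
        + norm (sqrt_iteration B m - sqrt_iteration B n)"
    using norm_triangle_ineq[of "sqrt_iteration B (Suc m) - sqrt_iteration B m"
        "sqrt_iteration B m - sqrt_iteration B n"] by (simp only: diff_add_cancel add_diff_eq)
  then show ?case
    using norm_sqrt_iteration_step_le[OF B, of m] step.IH by linarith
qed simp

lemma sqrt_iteration_convergent:
  fixes B :: "'a::banach \<Rightarrow>\<^sub>L 'a"
  assumes B: "norm B \<le> 1"
  shows "convergent (sqrt_iteration B)"
proof -
  have "incseq scalar_sqrt_iteration"
    using order_trans[OF norm_ge_zero norm_sqrt_iteration_step_le[OF B]]
    by (intro incseq_SucI) (simp only: diff_ge_0_iff_ge)
  then have "convergent scalar_sqrt_iteration"
    using scalar_sqrt_iteration_bounds(2) incseq_convergent convergent_def by metis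
  then have q: "Cauchy scalar_sqrt_iteration"
    by (rule convergent_Cauchy)
  have "Cauchy (sqrt_iteration B)"
  proof (rule metric_CauchyI)
    fix e :: real assume "e > 0"
    then obtain N where
      N: "\<And>m n. m \<ge> N \<Longrightarrow> n \<ge> N \<Longrightarrow> dist (scalar_sqrt_iteration m) (scalar_sqrt_iteration n) < e"
      using metric_CauchyD[OF q] by metis
    have "dist (sqrt_iteration B m) (sqrt_iteration B n) < e" if "m \<ge> N" "n \<ge> N" for m n
    proof -
      have "dist (sqrt_iteration B m) (sqrt_iteration B n)
          \<le> dist (scalar_sqrt_iteration m) (scalar_sqrt_iteration n)"
        using norm_sqrt_iteration_diff_le[OF B, of n m] norm_sqrt_iteration_diff_le[OF B, of m n]
        by (cases "n \<le> m") (simp_all add: dist_norm norm_minus_commute)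
      with N[OF that] show ?thesis by linarith
    qed
    then show "\<exists>N. \<forall>m\<ge>N. \<forall>n\<ge>N. dist (sqrt_iteration B m) (sqrt_iteration B n) < e"
      by blast
  qed
  then show ?thesis
    by (rule Cauchy_convergent)
qed

lemma sqrt_iteration_selfadjoint:
  fixes B :: "'a::complex_hilbert_space \<Rightarrow>\<^sub>L 'a"
  assumes "\<And>x y. cinner (B x) y = cinner x (B y)"
  shows "cinner (sqrt_iteration B n x) y = cinner x (sqrt_iteration B n y)"
proof (induction n arbitrary: x y)
  case (Suc n)
  then show ?case
    by (simp add: blinfun.bilinear_simps cinner_add_left cinner_add_right cinner_scaleR_left
        cinner_scaleR_right assms)
qed simp

lemma sqrt_fixpoint_exists:
  fixes B :: "'a::complex_hilbert_space \<Rightarrow>\<^sub>L 'a"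
  assumes B: "norm B \<le> 1" "\<And>x y. cinner (B x) y = cinner x (B y)"
  obtains L :: "'a \<Rightarrow>\<^sub>L 'a" where "norm L \<le> 1" "\<And>x. 2 *\<^sub>R L x = B x + L (L x)"
    "\<And>x y. cinner (L x) y = cinner x (L y)"
    "\<And>C x. C o\<^sub>L B = B o\<^sub>L C \<Longrightarrow> C (L x) = L (C x)"
proof -
  obtain L where L: "sqrt_iteration B \<longlonglongrightarrow> L"
    using sqrt_iteration_convergent[OF B(1)] convergent_def by blast
  have Lx: "(\<lambda>n. sqrt_iteration B n x) \<longlonglongrightarrow> L x" for x
    by (intro blinfun.tendsto L tendsto_const)
  have "norm L \<le> 1"
  proof (rule LIMSEQ_le_const2[OF tendsto_norm[OF L]])
    show "\<exists>N. \<forall>n\<ge>N. norm (sqrt_iteration B n) \<le> 1"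
      using norm_sqrt_iteration_le[OF B(1)] scalar_sqrt_iteration_bounds(2) order_trans by blast
  qed
  moreover have "2 *\<^sub>R L x = B x + L (L x)" for x
  proof (rule LIMSEQ_unique)
    show "(\<lambda>n. 2 *\<^sub>R sqrt_iteration B (Suc n) x) \<longlonglongrightarrow> 2 *\<^sub>R L x"
      by (intro tendsto_scaleR tendsto_const LIMSEQ_Suc[OF Lx])
    have "(\<lambda>n. B x + sqrt_iteration B n (sqrt_iteration B n x)) \<longlonglongrightarrow> B x + L (L x)"
      by (intro tendsto_add tendsto_const blinfun.tendsto L Lx)
    then show "(\<lambda>n. 2 *\<^sub>R sqrt_iteration B (Suc n) x) \<longlonglongrightarrow> B x + L (L x)"
      by (simp add: blinfun.bilinear_simps)
  qed
  moreover have "cinner (L x) y = cinner x (L y)" for x y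
  proof (rule LIMSEQ_unique)
    show "(\<lambda>n. cinner (sqrt_iteration B n x) y) \<longlonglongrightarrow> cinner (L x) y"
      by (intro tendsto_cinner Lx tendsto_const)
    show "(\<lambda>n. cinner (sqrt_iteration B n x) y) \<longlonglongrightarrow> cinner x (L y)"
      unfolding sqrt_iteration_selfadjoint[OF B(2)]
      by (intro tendsto_cinner Lx tendsto_const)
  qed
  moreover have "C (L x) = L (C x)" if C: "C o\<^sub>L B = B o\<^sub>L C" for C x
  proof (rule LIMSEQ_unique)
    show "(\<lambda>n. C (sqrt_iteration B n x)) \<longlonglongrightarrow> C (L x)"
      by (intro blinfun.tendsto Lx tendsto_const)
    have "C (sqrt_iteration B n x) = sqrt_iteration B n (C x)" for n
      using sqrt_iteration_commute[OF C, of n] by (metis blinfun_apply_blinfun_compose)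
    then show "(\<lambda>n. C (sqrt_iteration B n x)) \<longlonglongrightarrow> L (C x)"
      using Lx by simp
  qed
  ultimately show thesis
    by (rule that)
qed

text \<open>The root commutes with whatever commutes with \<open>P\<close>; in particular it commutes with every
  other root of \<open>P\<close>, which reduces uniqueness to the commuting case.\<close>

theorem positive_sqrt_exists:
  assumes P: "positive_operator P"
  shows "\<exists>A. positive_operator A \<and> A \<circ> A = P \<and>
    (\<forall>C. bounded_linear C \<longrightarrow> C \<circ> P = P \<circ> C \<longrightarrow> C \<circ> A = A \<circ> C)"
proof -
  note [simp] = bounded_clinearD(2-)[OF positive_operatorD(1)[OF P]]
  have bP: "bounded_linear P"
    using positive_operatorD(1)[OF P] bounded_clinearD(1) by blast
  obtain c where c: "c > 0" "\<And>x. norm (P x) \<le> c * norm x"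
    using bounded_linear.pos_bounded[OF bP] unfolding mult.commute[of "norm _"] by blast
  define B where "B = Blinfun (\<lambda>x. x - (1 / c) *\<^sub>R P x)"
  have B [simp]: "blinfun_apply B = (\<lambda>x. x - (1 / c) *\<^sub>R P x)"
    unfolding B_def
    by (intro bounded_linear_Blinfun_apply bounded_linear_sub bounded_linear_ident
        bounded_linear_compose[OF bounded_linear_scaleR_right bP])
  have norm_B: "norm B \<le> 1"
    by (rule norm_blinfun_bound) (simp_all add: positive_operator_contraction[OF P c])
  have "cinner (B x) y = cinner x (B y)" for x y
    by (simp add: cinner_diff_left cinner_diff_right cinner_scaleR_left cinner_scaleR_right
        positive_operator_selfadjoint[OF P])
  then obtain L :: "'a \<Rightarrow>\<^sub>L 'a" where L: "norm L \<le> 1" "\<And>x. 2 *\<^sub>R L x = B x + L (L x)"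
    "\<And>x y. cinner (L x) y = cinner x (L y)"
    and comm: "\<And>C x. C o\<^sub>L B = B o\<^sub>L C \<Longrightarrow> C (L x) = L (C x)"
    using sqrt_fixpoint_exists[OF norm_B] by blast
  have L_comm: "C (L x) = L (C x)" if C: "bounded_linear C" "\<And>x. C (P x) = P (C x)" for C x
  proof -
    interpret C: bounded_linear C by (rule C)
    have "Blinfun C o\<^sub>L B = B o\<^sub>L Blinfun C"
      by (rule blinfun_eqI)
        (simp add: bounded_linear_Blinfun_apply[OF C(1)] C.diff C.scaleR C(2))
    from comm[OF this] show ?thesis
      by (simp add: bounded_linear_Blinfun_apply[OF C(1)])
  qed
  \<comment> \<open>Complex homogeneity is commutation with the scalar multiplications.\<close>
  have L_scaleC: "L (r *\<^sub>C x) = r *\<^sub>C L x" for r x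
    using L_comm[OF bounded_linear_scaleC[of r]] by simp
  define A where "A x = sqrt c *\<^sub>R (x - L x)" for x
  have bA: "bounded_linear A"
    unfolding A_def
    by (intro bounded_linear_compose[OF bounded_linear_scaleR_right] bounded_linear_sub
        bounded_linear_ident blinfun.bounded_linear_right)
  have "positive_operator A"
  proof (rule positive_operatorI)
    show "bounded_clinear A"
      unfolding bounded_clinear_def
      by (auto simp: bA) (simp add: A_def L_scaleC complex_vector.scale_right_diff_distrib
          scaleR_eq_scaleC scaleC_scaleC mult.commute)
    show "cinner (A x) y = cinner x (A y)" for x y
      by (simp add: A_def cinner_scaleR_left cinner_scaleR_right cinner_diff_left
          cinner_diff_right L)
    show "0 \<le> inner (A x) x" for x
    proof -
      have "inner (L x) x \<le> norm (L x) * norm x"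
        by (rule norm_cauchy_schwarz)
      also have "\<dots> \<le> norm x * norm x"
        using L(1) norm_blinfun[of L x] mult_right_mono[OF L(1), of "norm x"]
        by (intro mult_right_mono) auto
      finally show ?thesis
        using c(1) by (simp add: A_def inner_diff_left dot_square_norm power2_eq_square)
    qed
  qed
  moreover have "A \<circ> A = P"
  proof
    fix x
    have "A (A x) = (sqrt c * sqrt c) *\<^sub>R (x - 2 *\<^sub>R L x + L (L x))"
      by (simp add: A_def blinfun.bilinear_simps algebra_simps scaleR_2)
    also have "\<dots> = P x"
      using c(1) by (simp add: L(2))
    finally show "(A \<circ> A) x = P x" by simp
  qed
  moreover have "C \<circ> A = A \<circ> C" if C: "bounded_linear C" "C \<circ> P = P \<circ> C" for C
  proof
    fix x
    interpret C: bounded_linear C by (rule C)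
    have "C (P x) = P (C x)" for x
      using C(2) by (metis comp_apply)
    then show "(C \<circ> A) x = (A \<circ> C) x"
      by (simp add: A_def C.scaleR C.diff L_comm[OF C(1)])
  qed
  ultimately show ?thesis by blast
qed

text \<open>For commuting square roots \<open>A\<close>, \<open>C\<close> and \<open>y = (A - C) x\<close> one has \<open>(A + C) y = 0\<close>; positivity
  turns this into \<open>A y = C y = 0\<close>, that is \<open>(A - C)\<^sup>2 x = 0\<close>.\<close>

lemma commuting_positive_sqrt_unique:
  assumes A: "positive_operator A" and C: "positive_operator C"
    and sq: "A \<circ> A = C \<circ> C" and comm: "C \<circ> A = A \<circ> C"
  shows "A = C"
proof
  fix x
  note [simp] = bounded_clinearD(2-)[OF positive_operatorD(1)[OF A]]
    bounded_clinearD(2-)[OF positive_operatorD(1)[OF C]]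
  have sq': "A (A z) = C (C z)" and comm': "C (A z) = A (C z)" for z
    using fun_cong[OF sq, of z] fun_cong[OF comm, of z] by simp_all
  define y where "y = A x - C x"
  have "A y + C y = 0"
    by (simp add: y_def sq' comm')
  then have "inner (A y) y + inner (C y) y = 0"
    by (metis inner_add_left inner_zero_left)
  then have "inner (A y) y = 0" "inner (C y) y = 0"
    using positive_operatorD(3)[OF A, of y] positive_operatorD(3)[OF C, of y] by linarith+
  then have "A y = 0" "C y = 0"
    using positive_operator_kernel A C by blast+
  then have "inner y y = 0"
    by (subst (2) y_def) (simp add: inner_diff_right flip: positive_operator_inner[OF A]
        positive_operator_inner[OF C])
  then show "A x = C x"
    by (simp add: y_def)
qed

lemma positive_operator_sqrt_operator:
  assumes P: "positive_operator P"
  shows "positive_operator (sqrt_operator P)"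
proof -
  obtain A where A: "positive_operator A" "A \<circ> A = P"
    and comm: "\<And>C. bounded_linear C \<Longrightarrow> C \<circ> P = P \<circ> C \<Longrightarrow> C \<circ> A = A \<circ> C"
    using positive_sqrt_exists[OF P] by blast
  have "sqrt_operator P = A"
    unfolding sqrt_operator_def
  proof (rule the_equality)
    fix C assume C: "positive_operator C \<and> C \<circ> C = P"
    then have "C \<circ> P = P \<circ> C"
      by (metis comp_assoc)
    moreover have "bounded_linear C"
      using C positive_operatorD(1) bounded_clinearD(1) by blast
    ultimately have "A \<circ> C = C \<circ> A"
      using comm by metis
    then show "C = A"
      using commuting_positive_sqrt_unique[of C A] A C by metis
  qed (use A in simp)
  then show ?thesis using A by simp
qed

lemma positive_operator_abs_operator:
  assumes T: "bounded_clinear T"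
  shows "positive_operator (abs_operator T)"
  unfolding abs_operator_def
proof (rule positive_operator_sqrt_operator, rule positive_operatorI)
  note adj = bounded_clinear_cadjoint[OF T]
  show "bounded_clinear (cadjoint T \<circ> T)"
    using bounded_linear_compose[OF bounded_clinearD(1)[OF adj] bounded_clinearD(1)[OF T]]
    by (simp add: bounded_clinear_def comp_def bounded_clinearD(4)[OF T] bounded_clinearD(4)[OF adj])
  show "cinner ((cadjoint T \<circ> T) x) y = cinner x ((cadjoint T \<circ> T) y)" for x y
    by (simp add: cinner_cadjoint'[OF T] flip: cinner_cadjoint[OF T])
  show "0 \<le> inner ((cadjoint T \<circ> T) x) x" for x
    by (simp add: inner_eq_Re_cinner cinner_cadjoint'[OF T] cinner_self)
qed

section \<open>Eigenvectors of positive operators\<close>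

lemma mem_eigenspace: "x \<in> eigenspace A \<mu> \<longleftrightarrow> A x = \<mu> *\<^sub>C x"
  by (simp add: eigenspace_def)

lemma csubspace_eigenspace:
  assumes "bounded_clinear A"
  shows "csubspace (eigenspace A \<mu>)"
  by (rule complex_vector.subspaceI)
    (auto simp: mem_eigenspace bounded_clinearD[OF assms] scaleC_add_right scaleC_scaleC mult.commute)

lemma closed_eigenspace:
  assumes "bounded_clinear A"
  shows "closed (eigenspace A \<mu>)"
  unfolding eigenspace_def
  by (intro closed_Collect_eq continuous_intros
      linear_continuous_on[OF bounded_clinearD(1)[OF assms]]
      linear_continuous_on[OF bounded_linear_scaleC])

lemma mem_point_spectrum:
  assumes "bounded_clinear A"
  shows "\<mu> \<in> point_spectrum A \<longleftrightarrow> (\<exists>x. x \<noteq> 0 \<and> A x = \<mu> *\<^sub>C x)"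
proof
  assume "\<mu> \<in> point_spectrum A"
  then obtain x y where "x \<noteq> y" "A x - \<mu> *\<^sub>C x = A y - \<mu> *\<^sub>C y"
    by (auto simp: point_spectrum_def inj_def)
  then show "\<exists>x. x \<noteq> 0 \<and> A x = \<mu> *\<^sub>C x"
    by (intro exI[of _ "x - y"])
      (simp add: bounded_clinearD[OF assms] complex_vector.scale_right_diff_distrib algebra_simps)
next
  assume "\<exists>x. x \<noteq> 0 \<and> A x = \<mu> *\<^sub>C x"
  then obtain x where "x \<noteq> 0" "A x = \<mu> *\<^sub>C x" by blast
  then have "A x - \<mu> *\<^sub>C x = A 0 - \<mu> *\<^sub>C 0"
    using bounded_clinearD(6)[OF assms] by simp
  with \<open>x \<noteq> 0\<close> show "\<mu> \<in> point_spectrum A"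
    unfolding point_spectrum_def inj_def by blast
qed

lemma positive_operator_eigenvalue:
  assumes A: "positive_operator A" and \<mu>: "\<mu> \<in> point_spectrum A"
  shows "\<mu> = complex_of_real (Re \<mu>)" "0 \<le> Re \<mu>"
proof -
  obtain x where x: "x \<noteq> 0" "A x = \<mu> *\<^sub>C x"
    using \<mu> mem_point_spectrum[OF positive_operatorD(1)[OF A]] by blast
  have "cinner (A x) x = \<mu> * complex_of_real ((norm x)\<^sup>2)"
    by (simp add: x(2) cinner_scaleC_left cinner_self)
  then have "Im \<mu> * (norm x)\<^sup>2 = 0" "0 \<le> Re \<mu> * (norm x)\<^sup>2"
    using positive_operatorD(2,3)[OF A, of x]
    by (simp_all add: complex_is_Real_iff inner_eq_Re_cinner)
  then show "\<mu> = complex_of_real (Re \<mu>)" "0 \<le> Re \<mu>"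
    using x(1) by (simp_all add: complex_eq_iff zero_le_mult_iff)
qed

lemma eigenspaces_orthogonal:
  assumes A: "positive_operator A" and neq: "\<mu> \<noteq> \<nu>"
    and x: "x \<in> eigenspace A \<mu>" and y: "y \<in> eigenspace A \<nu>"
  shows "cinner x y = 0"
proof (cases "y = 0")
  case False
  then have "\<nu> \<in> point_spectrum A"
    using y mem_point_spectrum[OF positive_operatorD(1)[OF A]] by (auto simp: mem_eigenspace)
  then have "cnj \<nu> = \<nu>"
    using positive_operator_eigenvalue(1)[OF A] by (metis complex_cnj_complex_of_real)
  then have "\<mu> * cinner x y = \<nu> * cinner x y"
    using positive_operator_selfadjoint[OF A, of x y] x y
    by (simp add: mem_eigenspace cinner_scaleC_left cinner_scaleC_right)
  then show ?thesis using neq by simp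
qed simp

lemma complement_invariant:
  assumes A: "positive_operator A" and N: "A ` N \<subseteq> N"
  shows "A ` corthogonal_complement N \<subseteq> corthogonal_complement N"
  using N
  by (simp add: image_subset_iff mem_corthogonal_complement positive_operator_selfadjoint[OF A])

lemma reducing_subspace_of_eigenvectors:
  assumes A: "positive_operator A" and G: "\<And>v. v \<in> G \<Longrightarrow> \<exists>\<mu>. A v = \<mu> *\<^sub>C v"
  shows "corthogonal_complement G \<in> reducing_subspaces A"
    "corthogonal_complement (corthogonal_complement G) \<in> reducing_subspaces A"
proof -
  have "A ` corthogonal_complement G \<subseteq> corthogonal_complement G"
  proof (clarsimp simp: mem_corthogonal_complement)
    fix y v assume y: "\<forall>x\<in>G. cinner y x = 0" and v: "v \<in> G"
    obtain \<mu> where "A v = \<mu> *\<^sub>C v" using G[OF v] by blast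
    then show "cinner (A y) v = 0"
      using y v by (simp add: positive_operator_selfadjoint[OF A] cinner_scaleC_right)
  qed
  moreover from this have "A ` corthogonal_complement (corthogonal_complement G)
      \<subseteq> corthogonal_complement (corthogonal_complement G)"
    by (rule complement_invariant[OF A])
  ultimately show "corthogonal_complement G \<in> reducing_subspaces A"
    "corthogonal_complement (corthogonal_complement G) \<in> reducing_subspaces A"
    by (simp_all add: reducing_subspaces_def triple_complement csubspace_corthogonal_complement
        closed_corthogonal_complement)
qed

lemma bdd_above_restriction:
  assumes "bounded_clinear T"
  shows "bdd_above ((\<lambda>y. norm (T y)) ` {y \<in> M. norm y = 1})"
proof -
  obtain K where "\<And>x. norm (T x) \<le> norm x * K"
    using bounded_linear.bounded[OF bounded_clinearD(1)[OF assms]] by blast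
  then have "norm (T y) \<le> K" if "norm y = 1" for y
    using that by (metis mult_1)
  then show ?thesis
    by (intro bdd_aboveI2[where M = K]) auto
qed

lemma norm_le_restriction_norm:
  assumes T: "bounded_clinear T" and M: "csubspace M" "x \<in> M"
  shows "norm (T x) \<le> restriction_norm T M * norm x"
proof (cases "x = 0")
  case False
  have "norm (T ((1 / norm x) *\<^sub>R x)) \<le> restriction_norm T M"
    unfolding restriction_norm_def
    using M False by (intro cSUP_upper bdd_above_restriction[OF T]) (auto simp: csubspace_scaleR)
  then show ?thesis
    using False by (simp add: bounded_clinearD[OF T] field_simps)
qed (simp add: bounded_clinearD[OF T])

text \<open>Equality \<open>\<parallel>A x\<parallel> = s\<close> in the norm bound forces equality in
  \<open>\<langle>A\<^sup>2 x, x\<rangle> = \<parallel>A x\<parallel>\<^sup>2 \<le> s\<^sup>2\<close>, so \<open>A\<^sup>2 x = s\<^sup>2 x\<close>. In \<open>(A + s) (A - s) x = 0\<close> the factor \<open>A + s\<close> is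
  injective by positivity unless \<open>s = 0\<close>.\<close>

lemma norm_attaining_vector_is_eigenvector:
  assumes A: "positive_operator A" and M: "A x \<in> M"
    and le: "\<And>y. y \<in> M \<Longrightarrow> norm (A y) \<le> s * norm y"
    and x: "norm x = 1" "norm (A x) = s"
  shows "A x = s *\<^sub>R x"
proof -
  note [simp] = bounded_clinearD[OF positive_operatorD(1)[OF A]]
  have Ax: "inner (A (A x)) x = s\<^sup>2"
    using x(2) positive_operator_inner[OF A, of "A x" x] by (simp add: dot_square_norm)
  have "norm (A (A x)) \<le> s * s"
    using le[OF M] x(2) by simp
  then have "(norm (A (A x)))\<^sup>2 \<le> (s * s)\<^sup>2"
    by (intro power_mono) simp_all
  have "(norm (A (A x) - s\<^sup>2 *\<^sub>R x))\<^sup>2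
      = (norm (A (A x)))\<^sup>2 - 2 * s\<^sup>2 * inner (A (A x)) x + (s\<^sup>2)\<^sup>2 * (norm x)\<^sup>2"
    unfolding power2_norm_eq_inner
    by (simp add: inner_diff_left inner_diff_right inner_commute algebra_simps power2_eq_square)
  also have "\<dots> \<le> 0"
    using \<open>(norm (A (A x)))\<^sup>2 \<le> (s * s)\<^sup>2\<close> by (simp add: Ax x(1) power2_eq_square)
  finally have sq: "A (A x) = s\<^sup>2 *\<^sub>R x"
    by simp
  show ?thesis
  proof (cases "s = 0")
    case True
    then show ?thesis using x(2) by simp
  next
    case False
    then have s: "s > 0" using x(2) norm_ge_zero[of "A x"] by linarith
    define y where "y = A x - s *\<^sub>R x"
    have "A y = - s *\<^sub>R y"
      by (simp add: y_def sq algebra_simps power2_eq_square)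
    then have "0 \<le> - s * inner y y"
      using positive_operatorD(3)[OF A, of y] by simp
    then have "inner y y \<le> 0"
      using s by (simp add: mult_le_0_iff)
    then have "y = 0"
      using inner_ge_zero[of y] inner_eq_zero_iff[of y] by linarith
    then show ?thesis
      by (simp add: y_def)
  qed
qed

section \<open>Absolutely norm attaining positive operators\<close>

lemma beta_eigenvector_of_maximal_modulus:
  assumes A: "positive_operator A" "A \<in> beta"
    and M: "M \<in> reducing_subspaces A" "M \<noteq> {0}"
  obtains x s where "x \<in> M" "x \<noteq> 0" "A x = complex_of_real s *\<^sub>C x"
    "\<And>y. y \<in> M \<Longrightarrow> norm (A y) \<le> s * norm y"
proof -
  have sub: "csubspace M" "A ` M \<subseteq> M"
    using M(1) by (auto simp: reducing_subspaces_def)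
  obtain x where x: "x \<in> M" "norm x = 1" "norm (A x) = restriction_norm A M"
    using A(2) M by (auto simp: beta_def norm_attaining_on_def)
  have le: "norm (A y) \<le> restriction_norm A M * norm y" if "y \<in> M" for y
    by (rule norm_le_restriction_norm[OF positive_operatorD(1)[OF A(1)] sub(1) that])
  have "A x = restriction_norm A M *\<^sub>R x"
    using norm_attaining_vector_is_eigenvector[OF A(1) _ le x(2,3)] sub(2) x(1) by blast
  moreover have "x \<noteq> 0"
    using x(2) by auto
  ultimately show thesis
    using that[OF x(1) _ _ le] by (simp add: scaleR_eq_scaleC)
qed

lemma beta_imp_pure_point_spectrum:
  assumes A: "positive_operator A" "A \<in> beta"
  shows "pure_point_spectrum A"
proof -
  define G where "G = {x. x \<noteq> 0 \<and> (\<exists>\<mu>. A x = \<mu> *\<^sub>C x)}"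
  have "corthogonal_complement G = {0}"
  proof (rule ccontr)
    assume ne: "corthogonal_complement G \<noteq> {0}"
    have "corthogonal_complement G \<in> reducing_subspaces A"
      by (rule reducing_subspace_of_eigenvectors[OF A(1)]) (auto simp: G_def)
    then obtain x s where x: "x \<in> corthogonal_complement G" "x \<noteq> 0"
      "A x = complex_of_real s *\<^sub>C x"
      by (rule beta_eigenvector_of_maximal_modulus[OF A _ ne])
    have "x \<in> G"
      unfolding G_def using x(2,3) by blast
    then show False
      using complement_disjoint x(1,2) by blast
  qed
  then show ?thesis
    unfolding pure_point_spectrum_def closure_cspan_eq_UNIV_iff G_def .
qed

text \<open>The norm of \<open>A\<close> on the closed span of the eigenspaces for eigenvalues in \<open>S\<close> bounds every
  element of \<open>S\<close>. Being attained, it is an eigenvalue with an eigenvector in that span, and since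
  eigenspaces are mutually orthogonal it has to belong to \<open>S\<close>.\<close>

lemma beta_imp_reverse_well_ordered:
  assumes A: "positive_operator A" "A \<in> beta"
  shows "reverse_well_ordered (point_spectrum A)"
  unfolding reverse_well_ordered_def
proof (intro conjI allI impI)
  show "point_spectrum A \<subseteq> \<real>"
    using positive_operator_eigenvalue(1)[OF A(1)] by (metis Reals_of_real subsetI)
next
  fix S assume S: "S \<subseteq> point_spectrum A \<and> S \<noteq> {}"
  define G where "G = (\<Union>\<mu>\<in>S. eigenspace A \<mu>)"
  define M where "M = corthogonal_complement (corthogonal_complement G)"
  have GM: "G \<subseteq> M"
    unfolding M_def by (rule subset_double_complement)
  have eigenvector: "\<exists>v\<in>M. v \<noteq> 0 \<and> A v = \<mu> *\<^sub>C v" if "\<mu> \<in> S" for \<mu>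
    using that S GM mem_point_spectrum[OF positive_operatorD(1)[OF A(1)], of \<mu>]
    by (force simp: G_def mem_eigenspace)
  have "M \<in> reducing_subspaces A"
    unfolding M_def
    by (rule reducing_subspace_of_eigenvectors[OF A(1)]) (auto simp: G_def mem_eigenspace)
  moreover have "M \<noteq> {0}"
    using S eigenvector by blast
  ultimately obtain x s where x: "x \<in> M" "x \<noteq> 0" "A x = complex_of_real s *\<^sub>C x"
    and le: "\<And>y. y \<in> M \<Longrightarrow> norm (A y) \<le> s * norm y"
    using beta_eigenvector_of_maximal_modulus[OF A] by blast
  have "complex_of_real s \<in> S"
  proof (rule ccontr)
    assume "complex_of_real s \<notin> S"
    then have "cinner x v = 0" if "\<mu> \<in> S" "v \<in> eigenspace A \<mu>" for v \<mu>
      using eigenspaces_orthogonal[OF A(1) _ _ that(2), of "complex_of_real s" x] x(3) that(1)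
      by (auto simp: mem_eigenspace)
    then have "x \<in> corthogonal_complement G"
      by (auto simp: mem_corthogonal_complement G_def)
    then show False
      using complement_disjoint x(1,2) by (auto simp: M_def)
  qed
  moreover have "Re \<mu> \<le> s" if \<mu>: "\<mu> \<in> S" for \<mu>
  proof -
    obtain v where "v \<in> M" "v \<noteq> 0" "A v = \<mu> *\<^sub>C v"
      using eigenvector[OF \<mu>] by blast
    then have "cmod \<mu> \<le> s"
      using le[of v] by (simp add: norm_scaleC)
    then show ?thesis
      using complex_Re_le_cmod[of \<mu>] by linarith
  qed
  ultimately show "\<exists>g\<in>S. \<forall>s\<in>S. Re s \<le> Re g"
    by (intro bexI[of _ "complex_of_real s"]) auto
qed

section \<open>Eigenvector expansions\<close>

lemma eigenprojection:
  assumes "bounded_clinear A"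
  shows "eigenprojection A \<mu> x \<in> eigenspace A \<mu>"
    and "x - eigenprojection A \<mu> x \<in> corthogonal_complement (eigenspace A \<mu>)"
  using orthogonal_projection[OF csubspace_eigenspace[OF assms] closed_eigenspace[OF assms]]
  by (simp_all add: eigenprojection_def)

lemma apply_eigenprojection:
  "bounded_clinear A \<Longrightarrow> A (eigenprojection A \<mu> x) = \<mu> *\<^sub>C eigenprojection A \<mu> x"
  using eigenprojection(1) mem_eigenspace by blast

text \<open>A linear combination of eigenvectors involves finitely many eigenvalues. Phrased by
  orthogonality, this is a condition on \<open>y\<close> that visibly defines a subspace and persists when \<open>F\<close>
  is enlarged.\<close>

lemma span_eigenvectors_finitely_many_eigenvalues:
  assumes A: "bounded_clinear A" and y: "y \<in> cspan {x. x \<noteq> 0 \<and> (\<exists>\<mu>. A x = \<mu> *\<^sub>C x)}"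
  shows "\<exists>F. finite F \<and> F \<subseteq> point_spectrum A \<and>
    (\<forall>z. (\<forall>\<mu>\<in>F. z \<in> corthogonal_complement (eigenspace A \<mu>)) \<longrightarrow> cinner z y = 0)"
    (is "\<exists>F. ?P F y")
proof -
  have "csubspace {y. \<exists>F. ?P F y}"
  proof (rule complex_vector.subspaceI; unfold mem_Collect_eq)
    show "\<exists>F. ?P F 0" by (intro exI[of _ "{}"]) auto
  next
    fix x y assume "\<exists>F. ?P F x" "\<exists>F. ?P F y"
    then obtain F F' where "?P F x" "?P F' y" by blast
    then show "\<exists>F. ?P F (x + y)"
      by (intro exI[of _ "F \<union> F'"]) (auto simp: cinner_add_right)
  next
    fix c x assume "\<exists>F. ?P F x"
    then obtain F where "?P F x" by blast
    then show "\<exists>F. ?P F (c *\<^sub>C x)"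
      by (intro exI[of _ F]) (auto simp: cinner_scaleC_right)
  qed
  moreover have "\<exists>F. ?P F x" if "x \<noteq> 0" "A x = \<mu> *\<^sub>C x" for x \<mu>
    using that mem_point_spectrum[OF A]
    by (intro exI[of _ "{\<mu>}"]) (auto simp: mem_corthogonal_complement mem_eigenspace)
  then have "{x. x \<noteq> 0 \<and> (\<exists>\<mu>. A x = \<mu> *\<^sub>C x)} \<subseteq> {y. \<exists>F. ?P F y}"
    by blast
  ultimately have "cspan {x. x \<noteq> 0 \<and> (\<exists>\<mu>. A x = \<mu> *\<^sub>C x)} \<subseteq> {y. \<exists>F. ?P F y}"
    by (intro complex_vector.span_minimal)
  with y show ?thesis by blast
qed

lemma eigenexpansion_remainder_orthogonal:
  assumes A: "positive_operator A" and F: "finite F" "\<mu> \<in> F"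
  shows "x - (\<Sum>\<nu>\<in>F. eigenprojection A \<nu> x) \<in> corthogonal_complement (eigenspace A \<mu>)"
  unfolding mem_corthogonal_complement
proof
  fix v assume v: "v \<in> eigenspace A \<mu>"
  note P = eigenprojection[OF positive_operatorD(1)[OF A]]
  have "cinner (\<Sum>\<nu>\<in>F. eigenprojection A \<nu> x) v = (\<Sum>\<nu>\<in>F. cinner (eigenprojection A \<nu> x) v)"
    by (rule bounded_linear.linear[OF
          bounded_bilinear.bounded_linear_left[OF bounded_bilinear_cinner], THEN linear_sum])
  also have "\<dots> = (\<Sum>\<nu>\<in>F. if \<nu> = \<mu> then cinner (eigenprojection A \<mu> x) v else 0)"
    using eigenspaces_orthogonal[OF A _ P(1) v] by (intro sum.cong) auto
  also have "\<dots> = cinner (eigenprojection A \<mu> x) v"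
    using F by simp
  finally show "cinner (x - (\<Sum>\<nu>\<in>F. eigenprojection A \<nu> x)) v = 0"
    using P(2)[of x \<mu>] v by (simp add: mem_corthogonal_complement cinner_diff_left)
qed

text \<open>Partial sums of the expansion are best approximations: once the partial sum covers the
  eigenvalues occurring in a linear combination \<open>y\<close> of eigenvectors, it is at least as close to
  \<open>x\<close> as \<open>y\<close> is.\<close>

theorem eigenexpansion_has_sum:
  assumes A: "positive_operator A" and pp: "pure_point_spectrum A"
  shows "((\<lambda>\<mu>. eigenprojection A \<mu> x) has_sum x) (point_spectrum A)"
  unfolding has_sum_def tendsto_iff eventually_finite_subsets_at_top
proof (intro allI impI)
  fix e :: real assume "e > 0"
  have bA: "bounded_clinear A"
    by (rule positive_operatorD(1)[OF A])
  have "x \<in> closure (cspan {x. x \<noteq> 0 \<and> (\<exists>\<mu>. A x = \<mu> *\<^sub>C x)})"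
    using pp by (simp add: pure_point_spectrum_def)
  then obtain y where y: "y \<in> cspan {x. x \<noteq> 0 \<and> (\<exists>\<mu>. A x = \<mu> *\<^sub>C x)}" "dist y x < e"
    using \<open>e > 0\<close> closure_approachable by blast
  obtain F where F: "finite F" "F \<subseteq> point_spectrum A"
    and y_orth: "\<forall>z. (\<forall>\<mu>\<in>F. z \<in> corthogonal_complement (eigenspace A \<mu>)) \<longrightarrow> cinner z y = 0"
    using span_eigenvectors_finitely_many_eigenvalues[OF bA y(1)] by (elim exE conjE)
  have "dist (\<Sum>\<mu>\<in>F'. eigenprojection A \<mu> x) x < e" if F': "finite F'" "F \<subseteq> F'" for F'
  proof -
    define p where "p = (\<Sum>\<mu>\<in>F'. eigenprojection A \<mu> x)"
    define z where "z = x - p"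
    \<comment> \<open>The remainder \<open>z\<close> is orthogonal to \<open>p\<close> and to \<open>y\<close>, so \<open>\<parallel>z\<parallel>\<^sup>2 = \<langle>z, x - y\<rangle>\<close>.\<close>
    have z: "z \<in> corthogonal_complement (eigenspace A \<mu>)" if "\<mu> \<in> F'" for \<mu>
      unfolding z_def p_def by (rule eigenexpansion_remainder_orthogonal[OF A F'(1) that])
    have "inner z (eigenprojection A \<mu> x) = 0" if "\<mu> \<in> F'" for \<mu>
      using z[OF that] eigenprojection(1)[OF bA]
      by (simp add: inner_eq_Re_cinner mem_corthogonal_complement)
    then have "inner z p = 0"
      by (simp add: p_def inner_sum_right)
    moreover have "inner z y = 0"
      using y_orth z F'(2) by (simp add: inner_eq_Re_cinner subset_iff)
    moreover have "inner z z = inner z x - inner z p"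
      by (simp add: z_def inner_diff_right)
    ultimately have "inner z z = inner z (x - y)"
      by (simp add: inner_diff_right)
    also have "\<dots> \<le> norm z * norm (x - y)"
      by (rule norm_cauchy_schwarz)
    finally have "norm z \<le> norm (x - y)"
      by (cases "z = 0") (simp_all add: dot_square_norm power2_eq_square)
    then show ?thesis
      using y(2) by (simp add: z_def p_def dist_norm norm_minus_commute)
  qed
  with F show "\<exists>X. finite X \<and> X \<subseteq> point_spectrum A \<and>
      (\<forall>Y. finite Y \<and> X \<subseteq> Y \<and> Y \<subseteq> point_spectrum A \<longrightarrow>
        dist (\<Sum>\<mu>\<in>Y. eigenprojection A \<mu> x) x < e)"
    by blast
qed

lemma apply_eigenexpansion_has_sum:
  assumes A: "positive_operator A" and pp: "pure_point_spectrum A"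
  shows "((\<lambda>\<mu>. \<mu> *\<^sub>C eigenprojection A \<mu> x) has_sum A x) (point_spectrum A)"
proof -
  have "((\<lambda>\<mu>. A (eigenprojection A \<mu> x)) has_sum A x) (point_spectrum A)"
    by (rule has_sum_bounded_linear[OF bounded_clinearD(1)[OF positive_operatorD(1)[OF A]]
          eigenexpansion_has_sum[OF A pp]])
  then show ?thesis
    by (simp add: apply_eigenprojection[OF positive_operatorD(1)[OF A]])
qed

text \<open>The components of an eigenvector in a reducing subspace and in its complement are again
  eigenvectors; for the projection of a point of the reducing subspace onto an eigenspace, the
  second component is orthogonal to itself.\<close>

lemma eigenprojection_mem_reducing_subspace:
  assumes A: "bounded_clinear A" and M: "M \<in> reducing_subspaces A" and x: "x \<in> M"
  shows "eigenprojection A \<mu> x \<in> M"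
proof -
  note [simp] = bounded_clinearD[OF A]
  have sub: "csubspace M" "closed M"
    and inv: "\<And>y. y \<in> M \<Longrightarrow> A y \<in> M"
      "\<And>y. y \<in> corthogonal_complement M \<Longrightarrow> A y \<in> corthogonal_complement M"
    using M by (auto simp: reducing_subspaces_def)
  define p where "p = eigenprojection A \<mu> x"
  obtain m where m: "m \<in> M" "p - m \<in> corthogonal_complement M"
    using projection_exists[OF sub] by blast
  define n where "n = p - m"
  have n: "n \<in> corthogonal_complement M"
    using m(2) by (simp add: n_def)
  have "A n - \<mu> *\<^sub>C n = - 1 *\<^sub>C (A m - \<mu> *\<^sub>C m)"
    using apply_eigenprojection[OF A, of \<mu> x]
    by (simp add: n_def p_def complex_vector.scale_right_diff_distrib)
  moreover have "- 1 *\<^sub>C (A m - \<mu> *\<^sub>C m) \<in> M"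
    using inv(1) m(1) sub(1)
    by (intro complex_vector.subspace_scale complex_vector.subspace_diff) auto
  moreover have "A n - \<mu> *\<^sub>C n \<in> corthogonal_complement M"
    using inv(2) n csubspace_corthogonal_complement
    by (intro complex_vector.subspace_scale complex_vector.subspace_diff) auto
  ultimately have "A n - \<mu> *\<^sub>C n = 0"
    using complement_disjoint by metis
  then have "cinner (x - p) n = 0"
    using eigenprojection(2)[OF A, of x \<mu>]
    by (simp add: p_def mem_corthogonal_complement mem_eigenspace)
  moreover have "cinner x n = 0" "cinner m n = 0"
    using n x m(1) cinner_eq_zero_commute by (auto simp: mem_corthogonal_complement)
  moreover have "x - p = x - m - n"
    by (simp add: n_def)
  ultimately have "cinner n n = 0"
    by (simp add: cinner_diff_left)
  then have "n = 0"
    by (simp add: cinner_self)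
  then show ?thesis
    using m(1) by (simp add: n_def p_def)
qed

lemma norm_le_of_eigenexpansion:
  assumes A: "positive_operator A" and pp: "pure_point_spectrum A"
    and g: "\<And>\<mu>. \<mu> \<in> point_spectrum A \<Longrightarrow> eigenprojection A \<mu> x \<noteq> 0 \<Longrightarrow> Re \<mu> \<le> g"
    and "0 \<le> g"
  shows "norm (A x) \<le> g * norm x"
proof -
  define P where "P \<mu> = eigenprojection A \<mu> x" for \<mu>
  have bA: "bounded_clinear A"
    by (rule positive_operatorD(1)[OF A])
  have orth: "orthogonal (P \<mu>) (P \<nu>)" if "\<mu> \<noteq> \<nu>" for \<mu> \<nu>
    using eigenspaces_orthogonal[OF A that eigenprojection(1)[OF bA] eigenprojection(1)[OF bA]]
    by (simp add: orthogonal_def inner_eq_Re_cinner P_def)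
  have orth': "orthogonal (\<mu> *\<^sub>C P \<mu>) (\<nu> *\<^sub>C P \<nu>)" if "\<mu> \<noteq> \<nu>" for \<mu> \<nu>
    using eigenspaces_orthogonal[OF A that eigenprojection(1)[OF bA] eigenprojection(1)[OF bA]]
    by (simp add: orthogonal_def inner_eq_Re_cinner P_def cinner_scaleC_left cinner_scaleC_right)
  have partial: "norm (\<Sum>\<mu>\<in>F. \<mu> *\<^sub>C P \<mu>) \<le> g * norm (\<Sum>\<mu>\<in>F. P \<mu>)"
    if F: "finite F" "F \<subseteq> point_spectrum A" for F
  proof (rule power2_le_imp_le)
    have "(norm (\<Sum>\<mu>\<in>F. \<mu> *\<^sub>C P \<mu>))\<^sup>2 = (\<Sum>\<mu>\<in>F. (norm (\<mu> *\<^sub>C P \<mu>))\<^sup>2)"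
      using F(1) orth' by (intro norm_sum_Pythagorean) (auto simp: pairwise_def)
    also have "\<dots> \<le> (\<Sum>\<mu>\<in>F. g\<^sup>2 * (norm (P \<mu>))\<^sup>2)"
    proof (rule sum_mono)
      fix \<mu> assume "\<mu> \<in> F"
      then have \<mu>: "\<mu> \<in> point_spectrum A" using F(2) by blast
      have "cmod \<mu> = Re \<mu>"
        using positive_operator_eigenvalue[OF A \<mu>] by (metis norm_of_real abs_of_nonneg)
      then have "norm (\<mu> *\<^sub>C P \<mu>) \<le> g * norm (P \<mu>)"
        using g[OF \<mu>] by (cases "P \<mu> = 0") (auto simp: P_def norm_scaleC)
      then show "(norm (\<mu> *\<^sub>C P \<mu>))\<^sup>2 \<le> g\<^sup>2 * (norm (P \<mu>))\<^sup>2"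
        by (simp add: power_mono flip: power_mult_distrib)
    qed
    also have "\<dots> = g\<^sup>2 * (norm (\<Sum>\<mu>\<in>F. P \<mu>))\<^sup>2"
      using F(1) orth by (subst norm_sum_Pythagorean) (auto simp: pairwise_def sum_distrib_left)
    finally show "(norm (\<Sum>\<mu>\<in>F. \<mu> *\<^sub>C P \<mu>))\<^sup>2 \<le> (g * norm (\<Sum>\<mu>\<in>F. P \<mu>))\<^sup>2"
      by (simp add: power_mult_distrib)
  qed (use \<open>0 \<le> g\<close> in simp)
  show ?thesis
  proof (rule tendsto_le)
    let ?\<F> = "finite_subsets_at_top (point_spectrum A)"
    show "((\<lambda>F. g * norm (\<Sum>\<mu>\<in>F. P \<mu>)) \<longlongrightarrow> g * norm x) ?\<F>"
      using eigenexpansion_has_sum[OF A pp, of x]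
      unfolding has_sum_def P_def by (intro tendsto_mult tendsto_const tendsto_norm)
    show "((\<lambda>F. norm (\<Sum>\<mu>\<in>F. \<mu> *\<^sub>C P \<mu>)) \<longlongrightarrow> norm (A x)) ?\<F>"
      using apply_eigenexpansion_has_sum[OF A pp, of x]
      unfolding has_sum_def P_def by (intro tendsto_norm)
    show "\<forall>\<^sub>F F in ?\<F>. norm (\<Sum>\<mu>\<in>F. \<mu> *\<^sub>C P \<mu>) \<le> g * norm (\<Sum>\<mu>\<in>F. P \<mu>)"
      by (rule eventually_finite_subsets_at_top_weakI) (rule partial)
  qed simp
qed

text \<open>On a reducing subspace \<open>M\<close> only eigenvalues with an eigenvector in \<open>M\<close> contribute to the
  expansion, and the largest of them is the norm of the restriction.\<close>

lemma pure_point_reverse_well_ordered_imp_beta: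
  assumes A: "positive_operator A" and pp: "pure_point_spectrum A"
    and rwo: "reverse_well_ordered (point_spectrum A)"
  shows "A \<in> beta"
proof -
  have bA: "bounded_clinear A"
    by (rule positive_operatorD(1)[OF A])
  have "norm_attaining_on A M" if M: "M \<in> reducing_subspaces A" "M \<noteq> {0}" for M
  proof -
    have sub: "csubspace M"
      using M(1) by (simp add: reducing_subspaces_def)
    define S where "S = {\<mu> \<in> point_spectrum A. \<exists>v\<in>M. v \<noteq> 0 \<and> A v = \<mu> *\<^sub>C v}"
    have in_S: "\<mu> \<in> S" if "x \<in> M" "\<mu> \<in> point_spectrum A" "eigenprojection A \<mu> x \<noteq> 0" for x \<mu>
      using that eigenprojection_mem_reducing_subspace[OF bA M(1)] apply_eigenprojection[OF bA]
      by (auto simp: S_def)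
    obtain x where x: "x \<in> M" "x \<noteq> 0"
      using M(2) complex_vector.subspace_0[OF sub] by blast
    have "S \<noteq> {}"
    proof
      assume "S = {}"
      then have "((\<lambda>\<mu>. eigenprojection A \<mu> x) has_sum 0) (point_spectrum A)"
        using in_S x(1) by (intro has_sum_0) auto
      then show False
        using has_sum_unique eigenexpansion_has_sum[OF A pp, of x] x(2) by blast
    qed
    moreover have "S \<subseteq> point_spectrum A"
      by (auto simp: S_def)
    ultimately obtain g where g: "g \<in> S" "\<And>\<mu>. \<mu> \<in> S \<Longrightarrow> Re \<mu> \<le> Re g"
      using rwo unfolding reverse_well_ordered_def by metis
    obtain v where v: "v \<in> M" "v \<noteq> 0" "A v = g *\<^sub>C v"
      using g(1) by (auto simp: S_def)
    define u where "u = (1 / norm v) *\<^sub>R v"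
    have u: "u \<in> M" "norm u = 1"
      using v sub by (simp_all add: u_def csubspace_scaleR)
    have gev: "g = complex_of_real (Re g)" "0 \<le> Re g"
      using g(1) positive_operator_eigenvalue[OF A] by (auto simp: S_def)
    have "norm (A u) = cmod g"
      using v(2) by (simp add: u_def bounded_clinearD[OF bA] v(3) norm_scaleC)
    then have Au: "norm (A u) = Re g"
      using gev by (metis norm_of_real abs_of_nonneg)
    have le: "norm (A y) \<le> Re g * norm y" if "y \<in> M" for y
      using g(2) in_S[OF that] by (intro norm_le_of_eigenexpansion[OF A pp] gev(2)) auto
    have "restriction_norm A M = norm (A u)"
      unfolding restriction_norm_def
    proof (rule cSup_eq_maximum)
      show "norm (A u) \<in> (\<lambda>y. norm (A y)) ` {y \<in> M. norm y = 1}"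
        using u by blast
      show "r \<le> norm (A u)" if "r \<in> (\<lambda>y. norm (A y)) ` {y \<in> M. norm y = 1}" for r
        using that le by (auto simp: Au) (metis mult.right_neutral)
    qed
    then show ?thesis
      using u by (auto simp: norm_attaining_on_def)
  qed
  then show ?thesis
    using bA by (simp add: beta_def)
qed

theorem theorem3p4:
  fixes T :: "'a::complex_hilbert_space \<Rightarrow> 'a"
  assumes infinite_dimensional: "\<not> (\<exists>B::'a set. finite B \<and> cspan B = UNIV)"
    and separable: "separable_space (euclidean :: 'a topology)"
    and T: "bounded_clinear T"
  shows "(T \<in> beta0 \<longleftrightarrow>
            pure_point_spectrum (abs_operator T) \<and>
            reverse_well_ordered (point_spectrum (abs_operator T))) \<and>
         (T \<in> beta0 \<longrightarrow>
            has_sum_sot (\<lambda>\<mu> x. \<mu> *\<^sub>C eigenprojection (abs_operator T) \<mu> x)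
              (abs_operator T) (point_spectrum (abs_operator T)))"
proof -
  have A: "positive_operator (abs_operator T)"
    by (rule positive_operator_abs_operator[OF T])
  have beta0: "T \<in> beta0 \<longleftrightarrow> abs_operator T \<in> beta"
    using T by (simp add: beta0_def)
  show ?thesis
    unfolding beta0 has_sum_sot_def
    using beta_imp_pure_point_spectrum[OF A] beta_imp_reverse_well_ordered[OF A]
      pure_point_reverse_well_ordered_imp_beta[OF A] apply_eigenexpansion_has_sum[OF A]
    by blast
qed

end
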